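(* Let $I\subseteq\mathbb{R}$ be an interval with interior $I^\circ$, let $a,b\in I^\circ$ with $a<b$, and let $f:I\to\mathbb{R}$ be differentiable on $I^\circ$. Let $g:[a,b]\to[0,\infty)$ be a differentiable function that is symmetric to $\frac{a+b}{2}$. If $|f'|$ is convex on $[a,b]$, then $$\left|\frac{f(a)+f(b)}{2}\int_a^b g(x)\,dx-\int_a^b f(x)g(x)\,dx\right|\leq \big(|f'(a)|+|f'(b)|\big)\int_a^{\frac{a+b}{2}} g(x)(x-a)\,dx.$$ Equivalently, $$\left|\frac{f(a)+f(b)}{2}\int_a^b g(x)\,dx-\int_a^b f(x)g(x)\,dx\right|\leq \big(|f'(a)|+|f'(b)|\big)\int_{\frac{a+b}{2}}^{b} g(x)(b-x)\,dx.$$ Also, if $g\equiv 1$, this gives the (previously known) inequality $$\left|\frac{f(a)+f(b)}{2}-\frac{1}{b-a}\int_a^b f(x)\,dx\right|\leq\frac{(b-a)\big(|f'(a)|+|f'(b)|\big)}{8}.$$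
   Context: A function $g:[a,b]\to\mathbb{R}$ is symmetric to $\frac{a+b}{2}$ if $g(x)=g(a+b-x)$ for all $x\in[a,b]$. *)

theory Defs
  imports "HOL-Analysis.Analysis"
begin

definition symmetric_to_midpoint :: "real \<Rightarrow> real \<Rightarrow> (real \<Rightarrow> real) \<Rightarrow> bool" where
  "symmetric_to_midpoint a b g \<longleftrightarrow> (\<forall>x\<in>{a..b}. g x = g (a + b - x))"

end

theory Submission
  imports Defs
begin

text \<open>
  Write \<open>m = (a + b) / 2\<close> and fold the integrals over \<open>{a..b}\<close> at \<open>m\<close>. Since \<open>g\<close> takes
  the same value at \<open>x\<close> and \<open>a + b - x\<close>, the quantity to be estimated becomes the integral
  over \<open>{m..b}\<close> of \<open>D x * g x\<close>, where \<open>D x = (f a + f b) - (f x + f (a + b - x))\<close>. Now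
  \<open>D x\<close> is the increment from \<open>x\<close> to \<open>b\<close> of the folded function \<open>\<lambda>x. f x + f (a + b - x)\<close>,
  whose derivative \<open>f' x - f' (a + b - x)\<close> is at most \<open>\<bar>f' a\<bar> + \<bar>f' b\<bar>\<close> in absolute value:
  at two points placed symmetrically in an interval, the values of a convex function have
  no larger sum than at the two endpoints (\<open>convex_on_reflected_sum_le\<close>). The mean value
  theorem gives \<open>\<bar>D x\<bar> \<le> (\<bar>f' a\<bar> + \<bar>f' b\<bar>) * (b - x)\<close> (\<open>trapezoid_increment_bound\<close>), and
  integration against the nonnegative weight \<open>g\<close> gives the bound by an integral over \<open>{m..b}\<close>
  (\<open>weighted_trapezoid_bound\<close>); reflection turns it into the integral over \<open>{a..m}\<close>. The
  derivative enters through the mean value theorem alone and is never integrated.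

  For \<open>g = 1\<close> the weight integral is \<open>(b - a)\<^sup>2 / 8\<close>, and one factor \<open>b - a\<close> cancels.
\<close>

lemma integral_reflect_Icc:
  fixes h :: "real \<Rightarrow> real"
  shows "integral {a..b} (\<lambda>x. h (c - x)) = integral {c - b..c - a} h"
proof -
  have "integral {a..b} (\<lambda>x. h (c - x)) = integral {-b..-a} (\<lambda>x. h (x + c))"
    using Henstock_Kurzweil_Integration.integral_reflect_real[of b a "\<lambda>x. h (c - x)"]
    by (simp add: add.commute)
  also have "\<dots> = integral {c - b..c - a} h"
    using integral_shift_real_ivl[of "c - b" c "c - a" h] by simp
  finally show ?thesis .
qed

lemma convex_on_reflected_sum_le:
  fixes \<phi> :: "real \<Rightarrow> real"
  assumes "convex_on {a..b} \<phi>" and "x \<in> {a..b}"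
  shows "\<phi> x + \<phi> (a + b - x) \<le> \<phi> a + \<phi> b"
proof -
  \<comment> \<open>Both points are compared with the chord over \<open>{a..b}\<close>; they are equally far from \<open>a\<close> and
    from \<open>b\<close> respectively, so the slope terms cancel in the sum.\<close>
  define s where "s = (\<phi> b - \<phi> a) / (b - a)"
  have "\<phi> x \<le> s * (x - a) + \<phi> a"
    unfolding s_def by (rule convex_onD_Icc'[OF assms])
  moreover have "\<phi> (a + b - x) \<le> - s * (x - a) + \<phi> b"
  proof -
    have "a + b - x \<in> {a..b}" using assms(2) by auto
    moreover have "(\<phi> a - \<phi> b) / (b - a) = - s"
      by (simp add: s_def diff_divide_distrib)
    ultimately show ?thesis
      using convex_onD_Icc''[OF assms(1), of "a + b - x"] by (simp only: diff_diff_eq2) simp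
  qed
  ultimately show ?thesis by simp
qed

text \<open>The mean value theorem for \<open>\<lambda>x. f x + f (a + b - x)\<close>, whose value at \<open>b\<close> is
  \<open>f a + f b\<close>.\<close>
lemma trapezoid_increment_bound:
  fixes f f' :: "real \<Rightarrow> real"
  assumes "\<And>x. x \<in> {a..b} \<Longrightarrow> (f has_real_derivative f' x) (at x within {a..b})"
    and "convex_on {a..b} (\<lambda>x. \<bar>f' x\<bar>)" and "x \<in> {a..b}"
  shows "\<bar>(f a + f b) - (f x + f (a + b - x))\<bar> \<le> (\<bar>f' a\<bar> + \<bar>f' b\<bar>) * (b - x)"
proof -
  define F where "F = (\<lambda>x. f x + f (a + b - x))"
  have deriv: "(F has_real_derivative f' y - f' (a + b - y)) (at y within {a..b})"
    if "y \<in> {a..b}" for y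
  proof -
    have img: "(\<lambda>x. a + b - x) ` {a..b} \<subseteq> {a..b}" by auto
    have "(f has_real_derivative f' (a + b - y)) (at (a + b - y) within (\<lambda>x. a + b - x) ` {a..b})"
      by (rule DERIV_subset[OF assms(1) img]) (use that in auto)
    moreover have "((\<lambda>x. a + b - x) has_real_derivative -1) (at y within {a..b})"
      by (auto intro!: derivative_eq_intros)
    ultimately have "((\<lambda>x. f (a + b - x)) has_real_derivative - f' (a + b - y)) (at y within {a..b})"
      using DERIV_image_chain[of f "f' (a + b - y)" "\<lambda>x. a + b - x" y "{a..b}" "-1"]
      by (simp add: o_def)
    from DERIV_add[OF assms(1)[OF that] this] show ?thesis by (simp add: F_def)
  qed
  have bound: "norm (f' y - f' (a + b - y)) \<le> \<bar>f' a\<bar> + \<bar>f' b\<bar>" if "y \<in> {a..b}" for y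
    using convex_on_reflected_sum_le[OF assms(2) that]
      abs_triangle_ineq4[of "f' y" "f' (a + b - y)"] by simp
  have "norm (F b - F x) \<le> (\<bar>f' a\<bar> + \<bar>f' b\<bar>) * norm (b - x)"
    using field_differentiable_bound[of "{a..b}" F "\<lambda>y. f' y - f' (a + b - y)" "\<bar>f' a\<bar> + \<bar>f' b\<bar>" b x]
      deriv bound assms(3) by auto
  then show ?thesis using assms(3) by (simp add: F_def add.commute)
qed

lemma symmetric_to_midpoint_integral_halves:
  fixes k :: "real \<Rightarrow> real"
  assumes "symmetric_to_midpoint a b g" and "a \<le> b"
  shows "integral {a..(a + b) / 2} (\<lambda>x. k x * g x)
       = integral {(a + b) / 2..b} (\<lambda>x. k (a + b - x) * g x)"
proof -
  have "integral {a..(a + b) / 2} (\<lambda>x. k x * g x)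
      = integral {(a + b) / 2..b} (\<lambda>x. k (a + b - x) * g (a + b - x))"
  proof -
    have eq: "{a + b - b..a + b - (a + b) / 2} = {a..(a + b) / 2}"
      by (rule arg_cong2[where f = atLeastAtMost]) (simp_all add: field_simps)
    show ?thesis
      using integral_reflect_Icc[of "(a + b) / 2" b "\<lambda>x. k x * g x" "a + b"]
      unfolding eq by (rule sym)
  qed
  also have "\<dots> = integral {(a + b) / 2..b} (\<lambda>x. k (a + b - x) * g x)"
  proof (rule integral_cong)
    fix x assume "x \<in> {(a + b) / 2..b}"
    then have "x \<in> {a..b}" using assms(2) by auto
    then have "g x = g (a + b - x)"
      using assms(1) unfolding symmetric_to_midpoint_def by blast
    then show "k (a + b - x) * g (a + b - x) = k (a + b - x) * g x"
      by (simp only:)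
  qed
  finally show ?thesis .
qed

lemma symmetric_to_midpoint_integral_fold:
  fixes k :: "real \<Rightarrow> real"
  assumes "symmetric_to_midpoint a b g" and "a \<le> b"
    and "continuous_on {a..b} k" and "continuous_on {a..b} g"
  shows "integral {a..b} (\<lambda>x. k x * g x)
       = integral {(a + b) / 2..b} (\<lambda>x. (k x + k (a + b - x)) * g x)"
proof -
  let ?m = "(a + b) / 2"
  have sub: "{?m..b} \<subseteq> {a..b}" using assms(2) by auto
  have int: "(\<lambda>x. k x * g x) integrable_on {a..b}"
    by (intro integrable_continuous_real continuous_intros assms)
  have ck: "continuous_on {?m..b} k" and cg: "continuous_on {?m..b} g"
    using assms(3,4) sub continuous_on_subset by blast+
  have ckr: "continuous_on {?m..b} (\<lambda>x. k (a + b - x))"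
    by (rule continuous_on_compose2[OF assms(3)]) (use assms(2) in \<open>auto intro!: continuous_intros\<close>)
  have "integral {a..b} (\<lambda>x. k x * g x)
      = integral {a..?m} (\<lambda>x. k x * g x) + integral {?m..b} (\<lambda>x. k x * g x)"
    using Henstock_Kurzweil_Integration.integral_combine[OF _ _ int, of ?m] assms(2) by simp
  also have "\<dots> = integral {?m..b} (\<lambda>x. k (a + b - x) * g x) + integral {?m..b} (\<lambda>x. k x * g x)"
    by (simp add: symmetric_to_midpoint_integral_halves[OF assms(1,2)])
  also have "\<dots> = integral {?m..b} (\<lambda>x. k (a + b - x) * g x + k x * g x)"
    by (intro Henstock_Kurzweil_Integration.integral_add [symmetric] integrable_continuous_real continuous_intros ck cg ckr)
  finally show ?thesis by (simp add: algebra_simps)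
qed

lemma weighted_trapezoid_bound:
  fixes f f' g :: "real \<Rightarrow> real"
  assumes "a \<le> b"
    and f': "\<And>x. x \<in> {a..b} \<Longrightarrow> (f has_real_derivative f' x) (at x within {a..b})"
    and "convex_on {a..b} (\<lambda>x. \<bar>f' x\<bar>)"
    and "continuous_on {a..b} g" and "\<And>x. x \<in> {a..b} \<Longrightarrow> 0 \<le> g x"
    and "symmetric_to_midpoint a b g"
  shows "\<bar>(f a + f b) / 2 * integral {a..b} g - integral {a..b} (\<lambda>x. f x * g x)\<bar>
       \<le> (\<bar>f' a\<bar> + \<bar>f' b\<bar>) * integral {(a + b) / 2..b} (\<lambda>x. g x * (b - x))"
proof -
  let ?m = "(a + b) / 2" and ?K = "\<bar>f' a\<bar> + \<bar>f' b\<bar>" and ?c = "(f a + f b) / 2"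
  have cf: "continuous_on {a..b} f"
    by (rule DERIV_continuous_on) (rule f')
  define D where "D = (\<lambda>x. (f a + f b) - (f x + f (a + b - x)))"
  have cg: "continuous_on {?m..b} g" and "continuous_on {?m..b} f"
    using continuous_on_subset[OF assms(4)] continuous_on_subset[OF cf] assms(1) by auto
  moreover have "continuous_on {?m..b} (\<lambda>x. f (a + b - x))"
    by (rule continuous_on_compose2[OF cf]) (use assms(1) in \<open>auto intro!: continuous_intros\<close>)
  ultimately have cD: "continuous_on {?m..b} D"
    unfolding D_def by (intro continuous_intros)
  have "?c * integral {a..b} g - integral {a..b} (\<lambda>x. f x * g x)
      = integral {a..b} (\<lambda>x. ?c * g x) - integral {a..b} (\<lambda>x. f x * g x)"
    by simp
  also have "\<dots> = integral {a..b} (\<lambda>x. ?c * g x - f x * g x)"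
    by (intro Henstock_Kurzweil_Integration.integral_diff[symmetric] integrable_continuous_real continuous_intros assms cf)
  also have "\<dots> = integral {a..b} (\<lambda>x. (?c - f x) * g x)"
    by (simp add: left_diff_distrib)
  \<comment> \<open>The fold is applied to \<open>?c - f\<close>: its values at \<open>x\<close> and at the mirror image add up to \<open>D x\<close>.\<close>
  also have "\<dots> = integral {?m..b} (\<lambda>x. ((?c - f x) + (?c - f (a + b - x))) * g x)"
    by (intro symmetric_to_midpoint_integral_fold assms cf continuous_intros)
  also have "\<dots> = integral {?m..b} (\<lambda>x. D x * g x)"
    by (rule integral_cong) (simp add: D_def field_simps)
  finally have "\<bar>?c * integral {a..b} g - integral {a..b} (\<lambda>x. f x * g x)\<bar>
      = norm (integral {?m..b} (\<lambda>x. D x * g x))" by simp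
  also have "\<dots> \<le> integral {?m..b} (\<lambda>x. ?K * (g x * (b - x)))"
  proof (rule integral_norm_bound_integral)
    show "(\<lambda>x. D x * g x) integrable_on {?m..b}"
      by (intro integrable_continuous_real continuous_intros cg cD)
    show "(\<lambda>x. ?K * (g x * (b - x))) integrable_on {?m..b}"
      by (intro integrable_continuous_real continuous_intros cg)
    fix x assume "x \<in> {?m..b}"
    then have x: "x \<in> {a..b}" using assms(1) by auto
    have "\<bar>D x\<bar> \<le> ?K * (b - x)"
      using trapezoid_increment_bound[OF f' assms(3) x] by (simp add: D_def)
    from mult_right_mono[OF this assms(5)[OF x]]
    show "norm (D x * g x) \<le> ?K * (g x * (b - x))"
      using assms(5)[OF x] by (simp add: abs_mult mult_ac)
  qed
  finally show ?thesis by simp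
qed

theorem corollary2p8:
  fixes I :: "real set" and a b :: real and f g :: "real \<Rightarrow> real"
  assumes "is_interval I"
    and "a \<in> interior I" and "b \<in> interior I" and "a < b"
    and "f differentiable_on interior I"
    and "\<forall>x\<in>{a..b}. g x \<ge> 0"
    and "g differentiable_on {a..b}"
    and "symmetric_to_midpoint a b g"
    and "convex_on {a..b} (\<lambda>x. \<bar>deriv f x\<bar>)"
  shows "\<bar>(f a + f b) / 2 * integral {a..b} g - integral {a..b} (\<lambda>x. f x * g x)\<bar>
           \<le> (\<bar>deriv f a\<bar> + \<bar>deriv f b\<bar>) * integral {a..(a + b) / 2} (\<lambda>x. g x * (x - a))
       \<and> (\<bar>(f a + f b) / 2 * integral {a..b} g - integral {a..b} (\<lambda>x. f x * g x)\<bar>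
           \<le> (\<bar>deriv f a\<bar> + \<bar>deriv f b\<bar>) * integral {a..(a + b) / 2} (\<lambda>x. g x * (x - a))
          \<longleftrightarrow>
          \<bar>(f a + f b) / 2 * integral {a..b} g - integral {a..b} (\<lambda>x. f x * g x)\<bar>
           \<le> (\<bar>deriv f a\<bar> + \<bar>deriv f b\<bar>) * integral {(a + b) / 2..b} (\<lambda>x. g x * (b - x)))
       \<and> ((\<forall>x\<in>{a..b}. g x = 1) \<longrightarrow>
          \<bar>(f a + f b) / 2 - 1 / (b - a) * integral {a..b} f\<bar>
           \<le> (b - a) * (\<bar>deriv f a\<bar> + \<bar>deriv f b\<bar>) / 8)"
proof -
  let ?K = "\<bar>deriv f a\<bar> + \<bar>deriv f b\<bar>" and ?m = "(a + b) / 2"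
  have "connected (interior I)"
    using assms(1) by (simp add: is_interval_convex_1 convex_connected convex_interior)
  then have sub: "{a..b} \<subseteq> interior I"
    using assms(2,3) connected_contains_Icc by blast
  have deriv_f: "(f has_real_derivative deriv f x) (at x within {a..b})" if "x \<in> {a..b}" for x
  proof -
    have "x \<in> interior I" using sub that by blast
    then have "f differentiable at x"
      using assms(5) differentiable_on_eq_differentiable_at open_interior by blast
    then have "(f has_real_derivative deriv f x) (at x)"
      by (simp add: DERIV_deriv_iff_real_differentiable)
    then show ?thesis by (rule has_field_derivative_at_within)
  qed
  have right: "\<bar>(f a + f b) / 2 * integral {a..b} g - integral {a..b} (\<lambda>x. f x * g x)\<bar>
      \<le> ?K * integral {?m..b} (\<lambda>x. g x * (b - x))"
    by (rule weighted_trapezoid_bound)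
      (use assms(4,6-9) deriv_f differentiable_imp_continuous_on in auto)
  have halves: "integral {a..?m} (\<lambda>x. g x * (x - a)) = integral {?m..b} (\<lambda>x. g x * (b - x))"
    using symmetric_to_midpoint_integral_halves[OF assms(8), of "\<lambda>x. x - a"] assms(4)
    by (simp add: mult.commute)
  have unweighted: "\<bar>(f a + f b) / 2 - 1 / (b - a) * integral {a..b} f\<bar> \<le> (b - a) * ?K / 8"
    if one: "\<forall>x\<in>{a..b}. g x = 1"
  proof -
    have "integral {a..b} g = integral {a..b} (\<lambda>_. 1)"
      by (rule integral_cong) (use one in simp)
    then have g: "integral {a..b} g = b - a" using assms(4) by simp
    have fg: "integral {a..b} (\<lambda>x. f x * g x) = integral {a..b} f"
      by (rule integral_cong) (use one in simp)
    have "integral {?m..b} (\<lambda>x. g x * (b - x)) = integral {?m..b} (\<lambda>x. b - x)"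
      by (rule integral_cong) (use one assms(4) in simp)
    moreover have "((\<lambda>x. b - x) has_integral (- ((b - b)\<^sup>2 / 2) - (- ((b - ?m)\<^sup>2 / 2)))) {?m..b}"
    proof (rule fundamental_theorem_of_calculus)
      show "?m \<le> b" using assms(4) by simp
      have "((\<lambda>x. - ((b - x)\<^sup>2 / 2)) has_real_derivative b - x) (at x within {?m..b})" for x
        by (auto intro!: derivative_eq_intros simp: field_simps)
      then show "((\<lambda>x. - ((b - x)\<^sup>2 / 2)) has_vector_derivative b - x) (at x within {?m..b})" for x
        by (simp only: has_real_derivative_iff_has_vector_derivative)
    qed
    moreover have "(b - ?m)\<^sup>2 / 2 = (b - a)\<^sup>2 / 8"
      by (simp add: power2_eq_square field_simps)
    ultimately have weight: "integral {?m..b} (\<lambda>x. g x * (b - x)) = (b - a)\<^sup>2 / 8"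
      by (simp add: integral_unique)
    have "(b - a) * \<bar>(f a + f b) / 2 - 1 / (b - a) * integral {a..b} f\<bar>
        = \<bar>(b - a) * ((f a + f b) / 2 - 1 / (b - a) * integral {a..b} f)\<bar>"
      using assms(4) by (simp add: abs_mult)
    also have "\<dots> = \<bar>(f a + f b) / 2 * (b - a) - integral {a..b} f\<bar>"
      using assms(4) by (simp add: right_diff_distrib mult.commute)
    also have "\<dots> \<le> (b - a) * ((b - a) * ?K / 8)"
      using right by (simp add: g fg weight power2_eq_square mult_ac)
    finally show ?thesis
      using assms(4) by (simp only: mult_le_cancel_left_pos[of "b - a"] diff_gt_0_iff_gt)
  qed
  show ?thesis
    using right halves unweighted by auto
qed

end
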